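(* Let $\phi=(1+\sqrt5)/2$ and, for $n\ge 0$, let $A_n=\lfloor \phi n\rfloor$ and $B_n=\lfloor \phi^2 n\rfloor$. For each integer $k\ge 0$, the $\mathcal{P}$-positions of the game $\mathcal{T}_k$ form the set $$\{(0,0)\}\cup\{(A_n+1,\,B_n+1)\mid n\ge 0\}.$$
   Context: For an integer $k\ge 0$, $\mathcal{T}_k$ is the following two-player game. A position is a pair $(a,b)$ of nonnegative integers (sizes of two piles of tokens); the piles are unordered, so $(a,b)$ and $(b,a)$ are identified, and a listed set of positions is understood up to this symmetry. Players alternate; a player who cannot move loses. From a position $(a,b)$ with $a\le b$, each move is one of: (i) remove a positive number of tokens from a single pile; (ii) remove an equal positive number $s$ of tokens from both piles, provided that $a-s>0$ and $\left|\left\lfloor \frac{b-s}{a-s}\right\rfloor-\left\lfloor\frac{b}{a}\right\rfloor\right|\le k$. A position is a $\mathcal{P}$-position if the player about to move from it does not have a winning strategy (the previous player wins); equivalently, if no move from it leads to a $\mathcal{P}$-position. *)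

theory Defs
  imports Complex_Main "HOL-Library.Uprod"
begin

(* Positions are unordered pairs of naturals; the hypothesis a <= b in the second rule
   only selects the representative. *)
inductive move :: "nat \<Rightarrow> nat uprod \<Rightarrow> nat uprod \<Rightarrow> bool" for k :: nat where
  single: "a' < a \<Longrightarrow> move k (Upair a b) (Upair a' b)"
| both: "\<lbrakk> a \<le> b; 0 < s; s < a;
      \<bar>\<lfloor>real (b - s) / real (a - s)\<rfloor> - \<lfloor>real b / real a\<rfloor>\<bar> \<le> int k \<rbrakk>
    \<Longrightarrow> move k (Upair a b) (Upair (a - s) (b - s))"

(* The player about to move from p has a winning strategy: some move leads to a position from
   which every reply of the opponent (there may be none) is again won by this player.
   A player who cannot move loses, so terminal positions are not winning. *)
inductive winning :: "nat \<Rightarrow> nat uprod \<Rightarrow> bool" for k :: nat where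
  "\<lbrakk> move k p q; \<And>r. move k q r \<Longrightarrow> winning k r \<rbrakk> \<Longrightarrow> winning k p"

definition P_position :: "nat \<Rightarrow> nat uprod \<Rightarrow> bool" where
  "P_position k p \<longleftrightarrow> \<not> winning k p"

lift_definition tokens :: "nat uprod \<Rightarrow> nat" is "\<lambda>(a, b). a + b"
  by auto

lemma tokens_Upair [simp]: "tokens (Upair a b) = a + b"
  by transfer simp

lemma move_tokens: "move k p q \<Longrightarrow> tokens q < tokens p"
  by (induction rule: move.induct) auto

lemma P_position_iff: "P_position k p \<longleftrightarrow> (\<forall>q. move k p q \<longrightarrow> \<not> P_position k q)"
proof (induction "tokens p" arbitrary: p rule: less_induct)
  case less
  have IH: "winning k q \<longleftrightarrow> (\<exists>r. move k q r \<and> \<not> winning k r)" if "move k p q" for q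
    using less[OF move_tokens[OF that]] by (auto simp: P_position_def)
  show ?case
    using IH winning.simps[of k p] by (auto simp: P_position_def)
qed

definition phi :: real where
  "phi = (1 + sqrt 5) / 2"

definition A :: "nat \<Rightarrow> nat" where
  "A n = nat \<lfloor>phi * real n\<rfloor>"

definition B :: "nat \<Rightarrow> nat" where
  "B n = nat \<lfloor>phi\<^sup>2 * real n\<rfloor>"

end

theory Submission
  imports Defs
begin

text \<open>
  The claimed set is Wythoff's set of cold positions \<open>(A n, B n)\<close>, shifted by one in both
  coordinates, together with the origin. The \<open>\<P>\<close>-positions are the only set of positions that no
  move links internally and that every outside position can enter in one move
  (\<open>P_position_iff_kernel\<close>), so it suffices to check these two properties for the claimed set.

  Both rest on two facts: \<open>B n = A n + n\<close>, so that the pair with index \<open>n\<close> is the only one with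
  difference \<open>n\<close>, and the Beatty partition, which says that every positive integer is an \<open>A n\<close> or
  a \<open>B n\<close> in exactly one way. By the partition two different positions of the claimed set share no pile size,
  so no single-pile move links them; by the differences no diagonal move does, except that
  \<open>(0, 0)\<close> and \<open>(1, 1)\<close> have the same difference, and there the rule that a diagonal move may not
  empty a pile intervenes. From a position outside the set one moves as in
  Wythoff's game. The extra condition on diagonal moves never obstructs this, even for \<open>k = 0\<close>:
  a diagonal move is needed only from \<open>(A n + 1, b)\<close> with \<open>A n + 1 \<le> b < B n + 1\<close>, and there, as in
  every shifted pair, the ratio of the larger pile to the smaller one lies
  in \<open>[1, 2)\<close>, because \<open>n \<le> A n\<close>.
\<close>

section \<open>The golden ratio and the Beatty partition\<close>

lemma phi_squared: "phi\<^sup>2 = phi + 1"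
  by (simp add: phi_def power2_eq_square field_simps)

lemma phi_mult_phi_mult: "phi * (phi * x) = (phi + 1) * x"
  using phi_squared by (simp add: power2_eq_square mult.assoc [symmetric])

lemma phi_gt_1: "phi > 1"
  by (simp add: phi_def real_less_rsqrt)

text \<open>If \<open>phi = m / n\<close> in lowest terms, then \<open>m\<^sup>2 = n * (m + n)\<close> makes \<open>n\<close> divide \<open>m\<^sup>2\<close>, which forces
  \<open>n = 1\<close>; but \<open>m\<^sup>2 = m + 1\<close> has no solution in the naturals.\<close>

lemma phi_irrational: "phi \<notin> \<rat>"
proof
  assume "phi \<in> \<rat>"
  then obtain m n :: nat where n: "n \<noteq> 0" and mn: "\<bar>phi\<bar> = real m / real n" and cop: "coprime m n"
    by (rule Rats_abs_nat_div_natE)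
  have "phi * real n = real m"
    using mn n phi_gt_1 by (simp add: field_simps)
  moreover have "(phi * real n)\<^sup>2 = phi * real n * real n + real n * real n"
    unfolding power_mult_distrib phi_squared by (simp add: algebra_simps power2_eq_square)
  ultimately have "real (m * m) = real (n * (m + n))"
    by (simp add: power2_eq_square algebra_simps)
  then have eq: "m * m = n * (m + n)"
    by (simp only: of_nat_eq_iff)
  then have "n dvd m * m"
    by simp
  then have "n = 1"
    using cop by (metis coprime_commute coprime_dvd_mult_left_iff coprime_common_divisor_nat dvd_refl)
  with eq have "m * m = m + 1"
    by simp
  then have "m dvd 1"
    by (metis dvd_add_right_iff dvd_refl dvd_triv_left)
  with \<open>m * m = m + 1\<close> show False
    by simp
qed

lemma phi_mult_nat_neq:
  assumes "n > 0"
  shows "phi * real n \<noteq> real j"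
proof
  assume "phi * real n = real j"
  then have "phi = real j / real n"
    using assms by (simp add: field_simps)
  then have "phi \<in> \<rat>"
    by (metis Rats_divide Rats_of_nat)
  with phi_irrational show False
    by contradiction
qed

lemma A_eq_iff: "A n = j \<longleftrightarrow> real j \<le> phi * real n \<and> phi * real n < real j + 1"
proof -
  have "phi * real n \<ge> 0"
    using phi_gt_1 by simp
  then have "A n = j \<longleftrightarrow> \<lfloor>phi * real n\<rfloor> = int j"
    unfolding A_def by (simp add: nat_eq_iff)
  then show ?thesis
    by (simp add: floor_eq_iff)
qed

lemma B_eq: "B n = A n + n"
proof -
  have "phi\<^sup>2 * real n = phi * real n + of_int (int n)"
    by (simp add: phi_squared algebra_simps)
  moreover have "phi * real n \<ge> 0"
    using phi_gt_1 by simp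
  ultimately show ?thesis
    unfolding A_def B_def by (simp only: floor_add_int [symmetric]) (simp add: nat_add_distrib)
qed

lemma A_0 [simp]: "A 0 = 0"
  by (simp add: A_def)

lemma strict_mono_A: "strict_mono A"
proof (rule strict_mono_Suc_iff [THEN iffD2], rule allI)
  fix n
  have "real (A n) \<le> phi * real n" "phi * real (Suc n) < real (A (Suc n)) + 1"
    using A_eq_iff by blast+
  then have "real (A n) < real (A (Suc n))"
    using phi_gt_1 by (simp add: algebra_simps)
  then show "A n < A (Suc n)"
    by simp
qed

lemma strict_mono_B: "strict_mono B"
  using strict_mono_A by (simp add: strict_mono_def B_eq add_less_mono)

lemma le_A: "n \<le> A n"
  using strict_mono_A by (rule strict_mono_imp_increasing)

text \<open>If \<open>phi * n\<close> and \<open>phi\<^sup>2 * m\<close> both lay in \<open>(j, j + 1)\<close>, then, because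
  \<open>1 / phi + 1 / phi\<^sup>2 = 1\<close>, the integer \<open>n + m\<close> would lie in \<open>(j, j + 1)\<close> as well. Below, dividing
  by \<open>phi\<close> is avoided by multiplying through by \<open>phi\<^sup>2\<close>.\<close>

lemma A_B_disjoint:
  assumes "A n = B m"
  shows "n = 0 \<and> m = 0"
proof (rule ccontr)
  assume nz: "\<not> (n = 0 \<and> m = 0)"
  have "0 < n"
  proof (rule ccontr)
    assume "\<not> 0 < n"
    with assms nz show False
      by (simp add: B_eq)
  qed
  define j where "j = A n"
  have n: "real j < phi * real n" "phi * real n < real j + 1"
    using A_eq_iff [of n j] phi_mult_nat_neq [OF \<open>0 < n\<close>, of j] by (auto simp: j_def)
  have "A m = j - m" "m \<le> j"
    using assms by (auto simp: B_eq j_def)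
  then have m: "real j \<le> (phi + 1) * real m" "(phi + 1) * real m < real j + 1"
    using A_eq_iff [of m "j - m"] by (auto simp: of_nat_diff algebra_simps)
  have split: "(phi + 1) * real (n + m) = phi * (phi * real n) + (phi + 1) * real m"
    unfolding phi_mult_phi_mult by (simp add: algebra_simps)
  have "phi * real j < phi * (phi * real n)" "phi * (phi * real n) < phi * (real j + 1)"
    using n phi_gt_1 by simp_all
  then have "(phi + 1) * real j < (phi + 1) * real (n + m)"
    and "(phi + 1) * real (n + m) < (phi + 1) * (real j + 1)"
    using m unfolding split by (simp_all add: algebra_simps)
  then have "real j < real (n + m)" "real (n + m) < real j + 1"
    using phi_gt_1 by (simp_all only: mult_less_cancel_left_pos)
  then have "j < n + m" "n + m < j + 1"
    by simp_all
  then show False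
    by simp
qed

text \<open>The candidate for \<open>n\<close> is the least one with \<open>j \<le> phi * n\<close>. If it overshoots \<open>j + 1\<close>, then no
  multiple of \<open>phi\<close> lies in \<open>[j, j + 1)\<close>, and counting by complements shows that \<open>m = j + 1 - n\<close> puts
  \<open>phi\<^sup>2 * m\<close> there.\<close>

lemma A_B_cover:
  assumes "0 < j"
  obtains n where "0 < n" "j = A n" | m where "0 < m" "j = B m"
proof -
  define n where "n = (LEAST n. real j \<le> phi * real n)"
  have "real j \<le> phi * real j"
    using mult_right_mono [of 1 phi "real j"] phi_gt_1 by simp
  then have n: "real j \<le> phi * real n" and "n \<le> j"
    unfolding n_def by (rule LeastI, rule Least_le)
  have "0 < n"
    using n assms by (cases n) auto
  then have n_pred: "phi * (real n - 1) < real j"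
    using not_less_Least [of "n - 1" "\<lambda>n. real j \<le> phi * real n"]
    by (simp add: n_def [symmetric] of_nat_diff not_le)
  show ?thesis
  proof (cases "phi * real n < real j + 1")
    case True
    then show ?thesis
      using n \<open>0 < n\<close> A_eq_iff [of n j] that(1) by auto
  next
    case False
    define m where "m = j + 1 - n"
    have "0 < m" and m: "real m = real j + 1 - real n"
      using \<open>n \<le> j\<close> by (auto simp: m_def of_nat_diff)
    (* Multiplying the bounds on n by phi turns them into bounds on phi^2 * m. *)
    have "phi * (phi * (real n - 1)) < phi * real j"
      using n_pred phi_gt_1 by simp
    then have lower: "real j < (phi + 1) * real m"
      unfolding m phi_mult_phi_mult by (simp add: algebra_simps)
    have "phi * (real j + 1) \<le> phi * (phi * real n)"
      using False phi_gt_1 by simp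
    then have "(phi + 1) * real m \<le> real j + 1"
      unfolding m phi_mult_phi_mult by (simp add: algebra_simps)
    moreover have "(phi + 1) * real m \<noteq> real j + 1"
    proof
      assume "(phi + 1) * real m = real j + 1"
      then have "phi * real m = real n"
        using m unfolding distrib_right by linarith
      with phi_mult_nat_neq [OF \<open>0 < m\<close>] show False
        by contradiction
    qed
    ultimately have upper: "(phi + 1) * real m < real j + 1"
      by simp
    have "m \<le> j"
      using \<open>0 < n\<close> by (simp add: m_def)
    then have "A m = j - m"
      using lower upper A_eq_iff [of m "j - m"] by (simp add: of_nat_diff algebra_simps)
    then have "j = B m"
      using \<open>m \<le> j\<close> by (simp add: B_eq)
    with \<open>0 < m\<close> show ?thesis
      by (rule that(2))
  qed
qed

section \<open>The shifted Wythoff pairs as a kernel of the game\<close>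

text \<open>Every move removes tokens, so the recursion that characterizes \<open>\<P>\<close>-positions is well founded
  and has only one solution.\<close>

lemma P_position_iff_kernel:
  assumes stable: "\<And>p q. \<lbrakk> move k p q; p \<in> S \<rbrakk> \<Longrightarrow> q \<notin> S"
    and absorbing: "\<And>p. p \<notin> S \<Longrightarrow> \<exists>q. move k p q \<and> q \<in> S"
  shows "P_position k p \<longleftrightarrow> p \<in> S"
proof (induction "tokens p" arbitrary: p rule: less_induct)
  case less
  have "P_position k q \<longleftrightarrow> q \<in> S" if "move k p q" for q
    using less move_tokens [OF that] by blast
  then show ?case
    using P_position_iff [of k p] stable absorbing by blast
qed

definition cold :: "nat uprod set" where
  "cold = {Upair 0 0} \<union> {Upair (A n + 1) (B n + 1) | n. True}"

lemma Upair_in_cold_iff: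
  "Upair a b \<in> cold \<longleftrightarrow>
    a = 0 \<and> b = 0 \<or> (\<exists>n. a = A n + 1 \<and> b = B n + 1 \<or> a = B n + 1 \<and> b = A n + 1)"
  by (auto simp: cold_def)

lemma shifted_pair_in_cold: "Upair (A n + 1) (B n + 1) \<in> cold"
  by (auto simp: cold_def)

text \<open>A single-pile move keeps one pile. A pile size greater than 1 determines its partner by the
  Beatty partition; the sizes 0 and 1 occur only in \<open>(0, 0)\<close> and \<open>(1, 1)\<close>.\<close>

lemma cold_partner_unique:
  assumes "Upair a b \<in> cold" and "Upair a' b \<in> cold"
  shows "a = a'"
proof -
  have A: "A m = A n \<longleftrightarrow> m = n" and B: "B m = B n \<longleftrightarrow> m = n" for m n
    using strict_mono_A strict_mono_B by (simp_all add: strict_mono_eq)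
  show ?thesis
    using assms A_B_disjoint unfolding Upair_in_cold_iff
    by (smt (verit) A B Suc_eq_plus1 add_right_cancel nat.distinct(1))
qed

text \<open>The difference of the two piles is the index of the pair. A diagonal move preserves it and keeps
  the smaller pile positive, so it cannot lead from one cold position to another.\<close>

lemma cold_smaller_pile:
  assumes "Upair a b \<in> cold" and "a \<le> b" and "0 < a"
  shows "a = A (b - a) + 1"
  using assms by (auto simp: Upair_in_cold_iff B_eq)

lemma cold_stable:
  assumes "move k p q" and "p \<in> cold"
  shows "q \<notin> cold"
  using assms
proof (cases rule: move.cases)
  case (single a' a b)
  then show ?thesis
    using cold_partner_unique assms(2) by blast
next
  case (both a b s)
  show ?thesis
  proof
    assume "q \<in> cold"
    then have "a - s = A (b - s - (a - s)) + 1"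
      using both by (intro cold_smaller_pile) auto
    moreover have "a = A (b - a) + 1"
      using both assms(2) by (intro cold_smaller_pile) auto
    moreover have "b - s - (a - s) = b - a"
      using both by simp
    ultimately show False
      using both by simp
  qed
qed

lemma floor_ratio_eq_1:
  assumes "a \<le> b" and "b < 2 * a"
  shows "\<lfloor>real b / real a\<rfloor> = 1"
proof -
  have "0 < a"
    using assms by linarith
  moreover have "real b < 2 * real a"
    using assms(2) by linarith
  ultimately show ?thesis
    using assms(1) by (simp add: floor_eq_iff field_simps)
qed

text \<open>This is the only place where the ratio condition on diagonal moves matters: both ratios have
  floor 1, so the move is legal for every \<open>k\<close>.\<close>

lemma diagonal_move_into_cold:
  assumes "A n + 1 \<le> b" and "b < B n + 1"
  shows "\<exists>q. move k (Upair (A n + 1) b) q \<and> q \<in> cold"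
proof -
  define d where "d = b - (A n + 1)"
  define s where "s = A n - A d"
  have "d < n"
    using assms by (simp add: d_def B_eq)
  then have "A d < A n"
    using strict_mono_A by (simp add: strict_mono_less)
  then have s: "0 < s" "s < A n + 1" "A n + 1 - s = A d + 1"
    by (simp_all add: s_def)
  have bs: "b - s = B d + 1"
    using assms(1) \<open>A d < A n\<close> by (simp add: s_def d_def B_eq)
  have "\<lfloor>real b / real (A n + 1)\<rfloor> = 1"
    using assms le_A [of n] by (intro floor_ratio_eq_1) (simp_all add: B_eq)
  moreover have "\<lfloor>real (B d + 1) / real (A d + 1)\<rfloor> = 1"
    using le_A [of d] by (intro floor_ratio_eq_1) (simp_all add: B_eq)
  ultimately have "move k (Upair (A n + 1) b) (Upair (A n + 1 - s) (b - s))"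
    using assms(1) s bs by (intro move.both) simp_all
  then show ?thesis
    using shifted_pair_in_cold [of d] unfolding s(3) bs by blast
qed

lemma cold_absorbing_ordered:
  assumes "a \<le> b" and "Upair a b \<notin> cold"
  shows "\<exists>q. move k (Upair a b) q \<and> q \<in> cold"
proof -
  have reduce: "\<exists>q. move k (Upair a b) q \<and> q \<in> cold" if "b' < b" "Upair a b' \<in> cold" for b'
    using move.single [OF that(1), of k a] that(2) by (metis Upair_inject)
  (* The Beatty partition starts at 1, so after the shift it covers pile sizes from 2 on. *)
  consider "a = 0" | "a = 1" | "0 < a - 1" "a = a - 1 + 1"
    by linarith
  then show ?thesis
  proof cases
    case 1
    then have "0 < b"
      using assms(2) by (auto simp: Upair_in_cold_iff)
    with 1 show ?thesis
      by (intro reduce [of 0]) (auto simp: Upair_in_cold_iff)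
  next
    case 2
    have origin: "Upair 1 1 \<in> cold"
      using shifted_pair_in_cold [of 0] by (simp add: B_eq)
    with 2 assms have "1 < b"
      by (cases "b = 1") auto
    with 2 origin show ?thesis
      by (intro reduce [of 1]) auto
  next
    case 3
    from \<open>0 < a - 1\<close> show ?thesis
    proof (cases rule: A_B_cover)
      case (1 n)
      then have a: "a = A n + 1"
        using 3 by simp
      then have "b \<noteq> B n + 1"
        using assms(2) shifted_pair_in_cold by auto
      then consider "B n + 1 < b" | "b < B n + 1"
        by linarith
      then show ?thesis
      proof cases
        case 1
        then show ?thesis
          using shifted_pair_in_cold [of n] by (intro reduce [of "B n + 1"]) (simp_all add: a)
      next
        case 2
        then show ?thesis
          using assms(1) diagonal_move_into_cold [of n b k] by (simp add: a)
      qed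
    next
      case (2 m)
      then have a: "a = B m + 1"
        using 3 by simp
      have "A m + 1 < b"
        using assms(1) \<open>0 < m\<close> by (simp add: a B_eq)
      then show ?thesis
        by (intro reduce [of "A m + 1"]) (auto simp: a Upair_in_cold_iff)
    qed
  qed
qed

lemma cold_absorbing:
  assumes "p \<notin> cold"
  shows "\<exists>q. move k p q \<and> q \<in> cold"
proof -
  obtain a b where p: "p = Upair a b"
    by (cases p)
  show ?thesis
  proof (cases "a \<le> b")
    case True
    then show ?thesis
      using assms cold_absorbing_ordered unfolding p by blast
  next
    case False
    have "p = Upair b a"
      by (simp add: p)
    then show ?thesis
      using False assms cold_absorbing_ordered [of b a k] by simp
  qed
qed

theorem theorem11:
  fixes k :: nat
  shows "{p. P_position k p} = {Upair 0 0} \<union> {Upair (A n + 1) (B n + 1) | n. True}"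
  using P_position_iff_kernel [of k cold] cold_stable cold_absorbing
  unfolding cold_def [symmetric] by blast

end
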